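(* Let $F_1,\dots,F_k$ be $d\times d$ positive semidefinite matrices with $\sum_{j=1}^k F_j\preceq\mathbb{I}$, and let $\lambda\in\mathbb{R}^k$. Let $\xi=\exp(\lambda\cdot F)/\operatorname{tr}\exp(\lambda\cdot F)$, let $P=\sum_{j}\operatorname{tr}(F_j\xi)\,|j\rangle\langle j|$ be the $k\times k$ diagonal matrix of mean values, and let $L$ be the $k\times k$ Hessian matrix of the function $\lambda\mapsto\ln\operatorname{tr}\exp(\lambda\cdot F)$ at $\lambda$. Then $L\preceq P$.
   Context: $\lambda\cdot F=\sum_j\lambda_jF_j$. $A\preceq B$ means $B-A$ is positive semidefinite. *)

theory Defs
  imports "HOL-Analysis.Analysis"
begin

primrec mpow :: "'a::semiring_1^'n^'n \<Rightarrow> nat \<Rightarrow> 'a^'n^'n" where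
  "mpow A 0 = mat 1"
| "mpow A (Suc m) = A ** mpow A m"

definition mexp :: "complex^'n^'n \<Rightarrow> complex^'n^'n" where
  "mexp A = (\<Sum>m. (1 / fact m) *\<^sub>R mpow A m)"

definition cadjoint :: "complex^'n^'n \<Rightarrow> complex^'n^'n" where
  "cadjoint A = (\<chi> i j. cnj (A $ j $ i))"

definition cpsd :: "complex^'n^'n \<Rightarrow> bool" where
  "cpsd A \<longleftrightarrow> cadjoint A = A \<and>
     (\<forall>x :: complex^'n. 0 \<le> Re (\<Sum>i\<in>UNIV. cnj (x $ i) * (A *v x) $ i))"

definition cloewner_le :: "complex^'n^'n \<Rightarrow> complex^'n^'n \<Rightarrow> bool" where
  "cloewner_le A B \<longleftrightarrow> cpsd (B - A)"

definition rpsd :: "real^'n^'n \<Rightarrow> bool" where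
  "rpsd A \<longleftrightarrow> transpose A = A \<and> (\<forall>x :: real^'n. 0 \<le> x \<bullet> (A *v x))"

definition rloewner_le :: "real^'n^'n \<Rightarrow> real^'n^'n \<Rightarrow> bool" where
  "rloewner_le A B \<longleftrightarrow> rpsd (B - A)"

definition lincomb :: "real^'k \<Rightarrow> ('k::finite \<Rightarrow> complex^'d^'d) \<Rightarrow> complex^'d^'d" where
  "lincomb lam F = (\<Sum>j\<in>UNIV. (lam $ j) *\<^sub>R F j)"

definition logZ :: "('k::finite \<Rightarrow> complex^'d^'d) \<Rightarrow> real^'k \<Rightarrow> real" where
  "logZ F lam = ln (Re (trace (mexp (lincomb lam F))))"

definition gibbs :: "('k::finite \<Rightarrow> complex^'d^'d) \<Rightarrow> real^'k \<Rightarrow> complex^'d^'d" where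
  "gibbs F lam = (1 / Re (trace (mexp (lincomb lam F)))) *\<^sub>R mexp (lincomb lam F)"

definition meanmat :: "('k::finite \<Rightarrow> complex^'d^'d) \<Rightarrow> real^'k \<Rightarrow> real^'k^'k" where
  "meanmat F lam = (\<chi> i j. if i = j then Re (trace (F i ** gibbs F lam)) else 0)"

end

theory Submission
  imports Defs
begin

text \<open>
  Put \<open>A = \<lambda> \<cdot> F\<close>, \<open>H = h \<cdot> F\<close>, \<open>B = A + t H\<close> and \<open>Z = tr exp\<close>. If \<open>a\<^sub>i, u\<^sub>i\<close> and \<open>b\<^sub>j, v\<^sub>j\<close> are the
  eigenvalues and orthonormal eigenvectors of \<open>A\<close> and \<open>B\<close>, then
  \<open>tr (f(A) g(B)) = \<Sum>i j. f(a\<^sub>i) g(b\<^sub>j) \<bar>\<langle>u\<^sub>i, v\<^sub>j\<rangle>\<bar>\<^sup>2\<close>, so scalar inequalities between \<open>a\<^sub>i\<close> and \<open>b\<^sub>j\<close>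
  become trace inequalities, and the matrix exponential never has to be differentiated:

  \<^item> \<open>exp b - exp a \<ge> (b - a) exp a\<close> shows that \<open>K \<mapsto> tr (K exp A)\<close> is a supporting linear form
    of \<open>Z\<close> at \<open>A\<close>, hence its derivative;

  \<^item> \<open>(b - a) (exp b - exp a) \<le> (b - a)\<^sup>2 (exp a + exp b) / 2\<close> bounds the difference quotient of
    this derivative along \<open>h\<close> by \<open>(tr (H\<^sup>2 exp A) + tr (H\<^sup>2 exp B)) / 2\<close>.

  Finally \<open>H\<^sup>2 \<preceq> \<Sum>j. h\<^sub>j\<^sup>2 F\<^sub>j\<close>, and \<open>t \<rightarrow> 0\<close> gives
  \<open>h \<bullet> L h + (\<nabla> ln Z \<bullet> h)\<^sup>2 \<le> h \<bullet> P h\<close>.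
\<close>

subsection \<open>Symmetry of the second derivative\<close>

text \<open>The mean value theorem in \<open>s\<close> along \<open>h\<close>, applied to the
  increment of \<open>f\<close> in direction \<open>k\<close>. The second-order difference on the
  left is symmetric in \<open>h\<close> and \<open>k\<close>, the right-hand side is not; comparing
  the two orders gives the symmetry of the Hessian.\<close>

lemma gradient_mixed_difference:
  fixes f :: "'a::real_inner \<Rightarrow> real"
  assumes grad: "\<And>x. (f has_derivative (\<lambda>h. G x \<bullet> h)) (at x)"
    and "0 < t"
  shows "\<exists>s. 0 < s \<and> s < t \<and>
    f (a + t *\<^sub>R h + t *\<^sub>R k) - f (a + t *\<^sub>R h) - f (a + t *\<^sub>R k) + f a
      = t * (h \<bullet> (G (a + s *\<^sub>R h + t *\<^sub>R k) - G (a + s *\<^sub>R h)))"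
proof -
  define \<phi> where "\<phi> s = f (a + s *\<^sub>R h + t *\<^sub>R k) - f (a + s *\<^sub>R h)" for s
  have d: "((\<lambda>s. f (c + s *\<^sub>R h)) has_real_derivative (G (c + s *\<^sub>R h) \<bullet> h)) (at s)" for c s
  proof -
    have "((\<lambda>s. c + s *\<^sub>R h) has_derivative (\<lambda>s. s *\<^sub>R h)) (at s)"
      by (auto intro!: derivative_eq_intros)
    from has_derivative_compose[OF this grad] show ?thesis
      by (simp add: has_field_derivative_def mult_commute_abs)
  qed
  have "DERIV \<phi> s :> G (a + s *\<^sub>R h + t *\<^sub>R k) \<bullet> h - G (a + s *\<^sub>R h) \<bullet> h" for s
    unfolding \<phi>_def
    using DERIV_diff[OF d[of "a + t *\<^sub>R k" s] d[of a s]] by (simp add: add_ac)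
  from MVT2[OF \<open>0 < t\<close> this] obtain s where "0 < s" "s < t"
    "\<phi> t - \<phi> 0 = (t - 0) * (G (a + s *\<^sub>R h + t *\<^sub>R k) \<bullet> h - G (a + s *\<^sub>R h) \<bullet> h)"
    by blast
  then show ?thesis
    by (intro exI[of _ s]) (simp add: \<phi>_def inner_diff_right inner_commute algebra_simps)
qed

text \<open>Linearising \<open>G\<close> at \<open>a\<close> shows that the mixed difference equals
  \<open>t * t * (h \<bullet> L k)\<close> as well as \<open>t * t * (k \<bullet> L h)\<close> up to
  an arbitrarily small multiple of \<open>t * t\<close>.\<close>

lemma second_derivative_symmetric:
  fixes f :: "'a::real_inner \<Rightarrow> real"
  assumes grad: "\<And>x. (f has_derivative (\<lambda>h. G x \<bullet> h)) (at x)"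
    and hess: "(G has_derivative L) (at a)"
  shows "h \<bullet> L k = k \<bullet> L h"
proof (rule ccontr)
  assume ne: "h \<bullet> L k \<noteq> k \<bullet> L h"
  define m where "m = norm h + norm k"
  \<comment> \<open>Chosen so that the total error \<open>4 * \<epsilon> * (m * m)\<close> stays
    strictly below the assumed gap; the \<open>+ 1\<close> gives strictness and covers
    \<open>m = 0\<close>.\<close>
  define \<epsilon> where "\<epsilon> = \<bar>h \<bullet> L k - k \<bullet> L h\<bar> / (4 * (m * m) + 1)"
  have "\<epsilon> > 0" using ne by (simp add: \<epsilon>_def add_nonneg_pos)
  have "m \<ge> 0" by (simp add: m_def)
  from hess have lin: "linear L" by (rule has_derivative_linear)
  obtain \<delta> where "\<delta> > 0"
    and \<delta>: "\<And>y. norm (y - a) < \<delta> \<Longrightarrow> norm (G y - G a - L (y - a)) \<le> \<epsilon> * norm (y - a)"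
    using hess \<open>\<epsilon> > 0\<close> unfolding has_derivative_at_alt by blast
  define t where "t = \<delta> / (2 * (m + 1))"
  have "t > 0" using \<open>\<delta> > 0\<close> \<open>m \<ge> 0\<close> by (simp add: t_def)
  have "t * m < \<delta>"
  proof -
    have "t * m \<le> t * (m + 1)" using \<open>t > 0\<close> by simp
    also have "\<dots> = \<delta> / 2" using \<open>m \<ge> 0\<close> by (simp add: t_def field_simps)
    finally show ?thesis using \<open>\<delta> > 0\<close> by simp
  qed
  have G: "norm (G (a + v) - G a - L v) \<le> \<epsilon> * (t * m)" if "norm v \<le> t * m" for v
  proof -
    have "norm (G (a + v) - G a - L v) \<le> \<epsilon> * norm v"
      using \<delta>[of "a + v"] that \<open>t * m < \<delta>\<close> by simp
    also have "\<dots> \<le> \<epsilon> * (t * m)" using that \<open>\<epsilon> > 0\<close> by simp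
    finally show ?thesis .
  qed
  define D where "D = f (a + t *\<^sub>R h + t *\<^sub>R k) - f (a + t *\<^sub>R h) - f (a + t *\<^sub>R k) + f a"
  \<comment> \<open>Stated for arbitrary \<open>h'\<close> and \<open>k'\<close> because it is used
    once in each order.\<close>
  have key: "\<bar>D - t * t * (h' \<bullet> L k')\<bar> \<le> t * t * (2 * \<epsilon> * (m * m))"
    if D: "D = t * (h' \<bullet> (G (a + s *\<^sub>R h' + t *\<^sub>R k') - G (a + s *\<^sub>R h')))"
      and s: "0 < s" "s < t" and hk: "norm h' + norm k' = m" for h' k' s
  proof -
    define r where "r v = G (a + v) - G a - L v" for v
    have s_h: "norm (s *\<^sub>R h') \<le> t * norm h'" using s by (simp add: mult_right_mono)
    then have n1: "norm (s *\<^sub>R h' + t *\<^sub>R k') \<le> t * m"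
      using norm_triangle_ineq[of "s *\<^sub>R h'" "t *\<^sub>R k'"] s unfolding hk[symmetric]
      by (simp add: distrib_left)
    have n2: "norm (s *\<^sub>R h') \<le> t * m"
      using s_h \<open>t > 0\<close> hk by (smt (verit) mult_left_mono norm_ge_zero)
    have "norm h' \<le> m" using hk by (metis add_increasing2 norm_ge_zero order_refl)
    \<comment> \<open>Both values of \<open>G\<close> are expanded around \<open>a\<close>, with
      remainder \<open>r\<close>. The terms \<open>L (s *\<^sub>R h')\<close> cancel, so the unknown
      \<open>s\<close> survives only in the remainders.\<close>
    have Gdiff: "G (a + s *\<^sub>R h' + t *\<^sub>R k') - G (a + s *\<^sub>R h')
        = t *\<^sub>R L k' + (r (s *\<^sub>R h' + t *\<^sub>R k') - r (s *\<^sub>R h'))"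
      by (simp add: r_def linear_add[OF lin] linear_cmul[OF lin] add_ac)
    have "D - t * t * (h' \<bullet> L k') = t * (h' \<bullet> (r (s *\<^sub>R h' + t *\<^sub>R k') - r (s *\<^sub>R h')))"
      unfolding D Gdiff by (simp add: inner_add_right distrib_left)
    also have "\<bar>\<dots>\<bar> \<le> t * (norm h' * norm (r (s *\<^sub>R h' + t *\<^sub>R k') - r (s *\<^sub>R h')))"
      using \<open>t > 0\<close> by (simp add: abs_mult Cauchy_Schwarz_ineq2)
    also have "\<dots> \<le> t * (m * (\<epsilon> * (t * m) + \<epsilon> * (t * m)))"
      using \<open>t > 0\<close> \<open>m \<ge> 0\<close> \<open>norm h' \<le> m\<close> G[OF n1] G[OF n2]
      unfolding r_def[symmetric]
      by (intro mult_left_mono mult_mono order_trans[OF norm_triangle_ineq4] add_mono) auto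
    finally show ?thesis by (simp add: algebra_simps)
  qed
  have 1: "\<bar>D - t * t * (h \<bullet> L k)\<bar> \<le> t * t * (2 * \<epsilon> * (m * m))"
    using gradient_mixed_difference[OF grad \<open>0 < t\<close>, of a h k] key[where h' = h and k' = k]
    unfolding D_def m_def by blast
  have D': "D = f (a + t *\<^sub>R k + t *\<^sub>R h) - f (a + t *\<^sub>R k) - f (a + t *\<^sub>R h) + f a"
    by (simp add: D_def add_ac)
  have 2: "\<bar>D - t * t * (k \<bullet> L h)\<bar> \<le> t * t * (2 * \<epsilon> * (m * m))"
    using gradient_mixed_difference[OF grad \<open>0 < t\<close>, of a k h] key[where h' = k and k' = h]
    unfolding D'[symmetric] by (force simp: m_def add.commute)
  have "t * t * \<bar>h \<bullet> L k - k \<bullet> L h\<bar> = \<bar>t * t * (h \<bullet> L k) - t * t * (k \<bullet> L h)\<bar>"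
    using \<open>t > 0\<close> by (simp add: abs_mult flip: right_diff_distrib)
  also have "\<dots> \<le> t * t * (4 * \<epsilon> * (m * m))" using 1 2 by linarith
  finally have "\<bar>h \<bullet> L k - k \<bullet> L h\<bar> \<le> 4 * \<epsilon> * (m * m)" using \<open>t > 0\<close> by simp
  also have "\<dots> < \<epsilon> * (4 * (m * m) + 1)" using \<open>\<epsilon> > 0\<close> by (simp add: algebra_simps)
  also have "\<dots> = \<bar>h \<bullet> L k - k \<bullet> L h\<bar>"
    unfolding \<epsilon>_def using zero_le_square[of m] by (simp add: add_nonneg_eq_0_iff)
  finally show False by simp
qed

subsection \<open>Spectral theorem for Hermitian matrices\<close>

text \<open>The library's \<open>\<bullet>\<close> on complex vectors is only the real part of this
  form; orthogonality over the complex numbers needs the full form.\<close>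

definition cinner :: "complex^'n \<Rightarrow> complex^'n \<Rightarrow> complex" where
  "cinner x y = (\<Sum>r\<in>UNIV. cnj (x $ r) * y $ r)"

lemma Re_cinner: "Re (cinner x y) = x \<bullet> y"
  by (simp add: cinner_def inner_vec_def inner_complex_def)

lemma cinner_commute: "cinner y x = cnj (cinner x y)"
  by (simp add: cinner_def mult.commute)

lemma cinner_add_right: "cinner x (y + z) = cinner x y + cinner x z"
  by (simp add: cinner_def distrib_left sum.distrib)

lemma cinner_scaleR_right: "cinner x (c *\<^sub>R y) = c *\<^sub>R cinner x y"
  by (simp add: cinner_def scaleR_sum_right)

lemma cinner_scaleR_left: "cinner (c *\<^sub>R x) y = c *\<^sub>R cinner x y"
  by (simp add: cinner_def scaleR_sum_right)

lemma cinner_self: "cinner x x = of_real ((norm x)\<^sup>2)"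
proof -
  have "Im (cinner x x) = 0"
    using cinner_commute[of x x] by (metis Reals_cnj_iff complex_is_Real_iff)
  then show ?thesis
    by (simp add: complex_eq_iff Re_cinner power2_norm_eq_inner)
qed

lemma continuous_on_cinner: "continuous_on S (cinner x)"
  unfolding cinner_def by (intro continuous_intros)

lemma cinner_adjoint: "cinner x (A *v y) = cinner (cadjoint A *v x) y"
proof -
  have "cinner x (A *v y) = (\<Sum>i\<in>UNIV. \<Sum>j\<in>UNIV. cnj (x $ i) * (A $ i $ j * y $ j))"
    by (simp add: cinner_def matrix_vector_mult_def sum_distrib_left)
  also have "\<dots> = (\<Sum>j\<in>UNIV. \<Sum>i\<in>UNIV. cnj (x $ i) * (A $ i $ j * y $ j))"
    by (rule sum.swap)
  also have "\<dots> = cinner (cadjoint A *v x) y"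
    by (simp add: cinner_def matrix_vector_mult_def sum_distrib_right sum_distrib_left
        cadjoint_def mult_ac)
  finally show ?thesis .
qed

lemma cpsd_altdef: "cpsd A \<longleftrightarrow> cadjoint A = A \<and> (\<forall>x. 0 \<le> x \<bullet> (A *v x))"
  by (simp add: cpsd_def Re_cinner[symmetric] cinner_def)

text \<open>The Rayleigh quotient is maximised over unit vectors of the orthogonal complement
  \<open>S\<close>, which \<open>A\<close> maps into itself. With \<open>b\<close> the maximum,
  \<open>q = b - A\<close> is nonnegative on \<open>S\<close> and its form vanishes at the maximiser
  \<open>x\<close>, which forces \<open>q x = 0\<close>.\<close>

lemma hermitian_eigenvector_orthogonal:
  fixes A :: "complex^'n^'n" and v :: "'n \<Rightarrow> complex^'n" and a :: "'n \<Rightarrow> real"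
  assumes herm: "cadjoint A = A" and eig: "\<And>j. j \<in> I \<Longrightarrow> A *v v j = a j *\<^sub>R v j"
    and "i \<notin> I"
  obtains x b where "norm x = 1" "\<And>j. j \<in> I \<Longrightarrow> cinner (v j) x = 0" "A *v x = b *\<^sub>R x"
proof -
  define S where "S = {x. \<forall>j\<in>I. cinner (v j) x = 0}"
  have subS: "subspace S"
    unfolding S_def subspace_def
    by (auto simp: cinner_add_right cinner_scaleR_right) (simp add: cinner_def)
  have "S = (\<Inter>j\<in>I. {x. cinner (v j) x = 0})" by (auto simp: S_def)
  then have "closed S"
    by (auto intro!: closed_INT closed_Collect_eq continuous_on_cinner)
  have AS: "A *v x \<in> S" if "x \<in> S" for x
    using that by (simp add: S_def cinner_adjoint herm eig cinner_scaleR_left)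
  \<comment> \<open>This replaces a dimension count: coordinate \<open>i\<close> of
    \<open>T x\<close> is always zero, so \<open>T\<close> is not surjective, hence not injective,
    and its kernel supplies a nonzero vector of \<open>S\<close>.\<close>
  define T :: "complex^'n \<Rightarrow> complex^'n"
    where "T x = (\<chi> j. if j \<in> I then cinner (v j) x else 0)" for x
  have linT: "linear T"
    by (intro linearI)
      (simp_all add: T_def vec_eq_iff cinner_add_right cinner_scaleR_right)
  have "\<not> surj T"
  proof
    assume "surj T"
    then obtain x where "T x = axis i 1" by (metis surjD)
    then have "T x $ i = 1" by (simp add: axis_def)
    with \<open>i \<notin> I\<close> show False by (simp add: T_def)
  qed
  then have "\<not> inj T" using linT linear_injective_imp_surjective by blast
  then obtain z where z: "T z = 0" "z \<noteq> 0" using linT linear_injective_0 by blast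
  have "z \<in> S" unfolding S_def
  proof safe
    fix j assume "j \<in> I"
    then have "T z $ j = cinner (v j) z" by (simp add: T_def)
    with z show "cinner (v j) z = 0" by simp
  qed
  have "compact (S \<inter> sphere 0 1)" using \<open>closed S\<close> by (simp add: closed_Int_compact)
  moreover have "(1 / norm z) *\<^sub>R z \<in> S \<inter> sphere 0 1"
    using z \<open>z \<in> S\<close> subS by (auto intro: subspace_scale)
  moreover have "continuous_on (S \<inter> sphere 0 1) (\<lambda>x. x \<bullet> (A *v x))"
    by (intro continuous_intros linear_continuous_on linear_linear[THEN iffD2])
       (auto simp: linear_conv_bounded_linear[symmetric])
  ultimately obtain x where x: "x \<in> S" "norm x = 1"
    and xmax: "\<And>y. y \<in> S \<Longrightarrow> norm y = 1 \<Longrightarrow> y \<bullet> (A *v y) \<le> x \<bullet> (A *v x)"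
    using continuous_attains_sup[of "S \<inter> sphere 0 1" "\<lambda>x. x \<bullet> (A *v x)"] by force
  define b where "b = x \<bullet> (A *v x)"
  define q where "q y = b *\<^sub>R y - A *v y" for y
  have sa: "y \<bullet> (A *v w) = (A *v y) \<bullet> w" for y w
    by (metis Re_cinner cinner_adjoint herm)
  have qpos: "0 \<le> y \<bullet> q y" if "y \<in> S" for y
  proof (cases "y = 0")
    case False
    have "((1 / norm y) *\<^sub>R y) \<bullet> (A *v ((1 / norm y) *\<^sub>R y)) \<le> b"
      unfolding b_def using False subS that by (intro xmax) (auto intro: subspace_scale)
    moreover have "A *v ((1 / norm y) *\<^sub>R y) = (1 / norm y) *\<^sub>R (A *v y)"
      by (rule linear_cmul) simp
    ultimately have "y \<bullet> (A *v y) / (norm y)\<^sup>2 \<le> b"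
      by (simp add: power2_eq_square)
    then show ?thesis
      using False by (simp add: q_def inner_diff_right divide_le_eq power2_norm_eq_inner)
  qed simp
  have qx: "x \<bullet> q x = 0"
    using x by (simp add: q_def inner_diff_right b_def norm_eq_1)
  have "q x \<in> S"
    using x subS AS by (simp add: q_def subspace_diff subspace_scale)
  have qlin: "linear q"
    unfolding q_def by (intro linear_compose_sub linear_scale_self) simp
  have sq: "y \<bullet> q w = q y \<bullet> w" for y w
    by (simp add: q_def inner_diff_right inner_diff_left sa)
  \<comment> \<open>The form of \<open>q\<close> is nonnegative at
    \<open>x - t *\<^sub>R q x\<close>. Its constant term vanishes by \<open>qx\<close>, so the
    linear term must be dominated by the quadratic one.\<close>
  have "2 * (q x \<bullet> q x) \<le> t * (q x \<bullet> q (q x))" if "t > 0" for t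
  proof -
    have "0 \<le> (x - t *\<^sub>R q x) \<bullet> q (x - t *\<^sub>R q x)"
      using x \<open>q x \<in> S\<close> subS by (intro qpos) (simp add: subspace_diff subspace_scale)
    also have "\<dots> = t * (t * (q x \<bullet> q (q x)) - 2 * (q x \<bullet> q x))"
      using qlin qx
      by (simp add: linear_diff linear_cmul inner_diff_left inner_diff_right sq[of x] algebra_simps)
    finally show ?thesis using that by (simp add: zero_le_mult_iff)
  qed
  note small = this
  have "q x \<bullet> q x \<le> 0"
  proof (rule ccontr)
    assume neg: "\<not> q x \<bullet> q x \<le> 0"
    define c where "c = q x \<bullet> q (q x)"
    \<comment> \<open>Here \<open>t\<close> is
      \<open>(q x \<bullet> q x) / (\<bar>c\<bar> + 1)\<close>, small enough that the quadratic term
      is at most \<open>q x \<bullet> q x\<close>.\<close>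
    have "2 * (q x \<bullet> q x) \<le> (q x \<bullet> q x / (\<bar>c\<bar> + 1)) * c"
      unfolding c_def using neg by (intro small) (auto intro!: divide_pos_pos)
    also have "\<dots> = (q x \<bullet> q x) * (c / (\<bar>c\<bar> + 1))" by simp
    also have "\<dots> \<le> (q x \<bullet> q x) * 1"
      using neg by (intro mult_left_mono) (auto simp: divide_le_eq)
    finally show False using neg by simp
  qed
  then have "q x = 0" by (metis inner_eq_zero_iff inner_ge_zero order_antisym)
  then have "A *v x = b *\<^sub>R x" by (simp add: q_def)
  with x that show ?thesis by (auto simp: S_def)
qed

text \<open>Eigenvectors are labelled by the index type of the matrix itself, so induction up to
  \<open>I = UNIV\<close> yields exactly as many as a square matrix has columns.\<close>

lemma hermitian_orthonormal_eigenvectors: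
  fixes A :: "complex^'n^'n"
  assumes herm: "cadjoint A = A" and "finite I"
  shows "\<exists>v a. (\<forall>i\<in>I. A *v v i = (a i :: real) *\<^sub>R v i) \<and>
    (\<forall>i\<in>I. \<forall>j\<in>I. cinner (v i) (v j) = (if i = (j::'n) then 1 else 0))"
  using \<open>finite I\<close>
proof induction
  case (insert i I)
  obtain v and a :: "'n \<Rightarrow> real" where
    IH: "\<forall>i\<in>I. A *v v i = a i *\<^sub>R v i"
      "\<forall>i\<in>I. \<forall>j\<in>I. cinner (v i) (v j) = (if i = j then 1 else 0)"
    using insert.IH by blast
  from IH have v: "\<And>i. i \<in> I \<Longrightarrow> A *v v i = a i *\<^sub>R v i"
    and on: "\<And>i j. i \<in> I \<Longrightarrow> j \<in> I \<Longrightarrow> cinner (v i) (v j) = (if i = j then 1 else 0)"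
    by blast+
  obtain x b where x: "norm x = 1" "\<And>j. j \<in> I \<Longrightarrow> cinner (v j) x = 0" "A *v x = b *\<^sub>R x"
    using hermitian_eigenvector_orthogonal[of A I v a i] herm v \<open>i \<notin> I\<close> by blast
  have "cinner x (v j) = 0" if "j \<in> I" for j
    using x(2)[OF that] by (simp add: cinner_commute[of x])
  moreover have "cinner x x = 1" by (simp add: cinner_self x)
  ultimately show ?case
    using v on x \<open>i \<notin> I\<close>
    by (intro exI[of _ "v(i := x)"] exI[of _ "a(i := b)"]) auto
qed simp

definition cdiag :: "('n \<Rightarrow> real) \<Rightarrow> complex^'n^'n" where
  "cdiag a = (\<chi> i j. if i = j then of_real (a i) else 0)"

lemma matrix_mult_cdiag_nth: "(M ** cdiag a) $ i $ j = M $ i $ j * of_real (a j)"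
  by (simp add: matrix_matrix_mult_def cdiag_def if_distrib cong: if_cong)

lemma cdiag_mult: "cdiag a ** cdiag b = cdiag (\<lambda>i. a i * b i)"
  by (simp add: vec_eq_iff matrix_mult_cdiag_nth) (simp add: cdiag_def)

definition unitary :: "complex^'n^'n \<Rightarrow> bool" where
  "unitary U \<longleftrightarrow> cadjoint U ** U = mat 1 \<and> U ** cadjoint U = mat 1"

text \<open>This encodes the functional calculus: if \<open>A = conjdiag U a\<close> with
  \<open>U\<close> unitary, then replacing \<open>a\<close> by \<open>\<lambda>i. f (a i)\<close>
  gives f(A).\<close>

definition conjdiag :: "complex^'n^'n \<Rightarrow> ('n \<Rightarrow> real) \<Rightarrow> complex^'n^'n" where
  "conjdiag U a = U ** cdiag a ** cadjoint U"

theorem hermitian_unitary_diagonalization: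
  fixes A :: "complex^'n^'n"
  assumes herm: "cadjoint A = A"
  obtains U a where "unitary U" "A = conjdiag U a"
proof -
  obtain v and a :: "'n \<Rightarrow> real" where
    v: "\<And>i. A *v v i = a i *\<^sub>R v i"
    and on: "\<And>i j. cinner (v i) (v j) = (if i = j then 1 else 0)"
    using hermitian_orthonormal_eigenvectors[OF herm, of UNIV] by auto
  define U :: "complex^'n^'n" where "U = (\<chi> r i. v i $ r)"
  have "cadjoint U ** U = mat 1"
    using on by (simp add: vec_eq_iff matrix_matrix_mult_def cadjoint_def U_def mat_def cinner_def)
  then have U: "unitary U"
    by (simp add: unitary_def matrix_left_right_inverse)
  have "(A ** U) $ r $ i = (U ** cdiag a) $ r $ i" for r i
  proof -
    have "(A ** U) $ r $ i = (A *v v i) $ r"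
      by (simp add: matrix_matrix_mult_def matrix_vector_mult_def U_def)
    also have "\<dots> = of_real (a i) * v i $ r"
      unfolding v vector_scaleR_component by (rule scaleR_conv_of_real)
    finally show ?thesis by (simp add: matrix_mult_cdiag_nth U_def)
  qed
  then have "A ** U = U ** cdiag a" by (simp add: vec_eq_iff)
  then have "A = conjdiag U a"
    using U by (metis conjdiag_def matrix_mul_assoc matrix_mul_rid unitary_def)
  with U that show ?thesis by blast
qed

subsection \<open>Trace inequalities for the exponential\<close>

lemma matrix_diff_ldistrib: "A ** (B - C) = A ** B - A ** (C :: 'a::ring_1^'m^'n)"
  by (vector matrix_matrix_mult_def sum_subtractf[symmetric] right_diff_distrib)

lemma matrix_diff_rdistrib: "(A - B) ** C = A ** C - B ** (C :: 'a::ring_1^'m^'n)"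
  by (vector matrix_matrix_mult_def sum_subtractf[symmetric] left_diff_distrib)

lemma matrix_sum_rdistrib: "(\<Sum>i\<in>S. A i) ** C = (\<Sum>i\<in>S. A i ** (C :: complex^'m^'n))"
  by (simp add: vec_eq_iff matrix_matrix_mult_def sum_distrib_right sum.swap[of _ S])

section \<open>Functional calculus in an eigenbasis\<close>

lemma conjdiag_mult:
  assumes "unitary U"
  shows "conjdiag U a ** conjdiag U b = conjdiag U (\<lambda>i. a i * b i)"
proof -
  have "conjdiag U a ** conjdiag U b = U ** cdiag a ** (cadjoint U ** U) ** cdiag b ** cadjoint U"
    by (simp add: conjdiag_def matrix_mul_assoc)
  also have "\<dots> = U ** (cdiag a ** cdiag b) ** cadjoint U"
    using assms by (simp add: unitary_def matrix_mul_assoc)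
  finally show ?thesis by (simp add: conjdiag_def cdiag_mult)
qed

lemma cdiag_one: "cdiag (\<lambda>_. 1) = mat 1"
  by (simp add: cdiag_def mat_def cong: if_cong)

lemma conjdiag_one: "unitary U \<Longrightarrow> conjdiag U (\<lambda>_. 1) = mat 1"
  by (simp add: conjdiag_def unitary_def cdiag_one)

text \<open>The spectral decomposition into rank-one matrices. The eigenvalues enter as scalar
  coefficients, so matrix series reduce to scalar series.\<close>

lemma conjdiag_eq_sum:
  "conjdiag U a = (\<Sum>i\<in>UNIV. a i *\<^sub>R (\<chi> r s. U $ r $ i * cnj (U $ s $ i)))"
  unfolding vec_eq_iff conjdiag_def
  by (simp add: matrix_matrix_mult_def[of "U ** cdiag a"] matrix_mult_cdiag_nth cadjoint_def)
     (simp add: scaleR_conv_of_real mult_ac)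

lemma mpow_conjdiag:
  assumes "unitary U"
  shows "mpow (conjdiag U a) m = conjdiag U (\<lambda>i. a i ^ m)"
  by (induction m) (simp_all add: conjdiag_one conjdiag_mult assms)

lemma mexp_conjdiag:
  assumes "unitary U"
  shows "mexp (conjdiag U a) = conjdiag U (\<lambda>i. exp (a i))"
proof -
  have "(\<lambda>m. (1 / fact m * a i ^ m) *\<^sub>R (\<chi> r s. U $ r $ i * cnj (U $ s $ i)))
      sums (exp (a i) *\<^sub>R (\<chi> r s. U $ r $ i * cnj (U $ s $ i)))" for i
    using exp_converges[of "a i"] by (intro sums_scaleR_left) (simp add: field_simps)
  then have "(\<lambda>m. (1 / fact m) *\<^sub>R mpow (conjdiag U a) m) sums conjdiag U (\<lambda>i. exp (a i))"
    unfolding mpow_conjdiag[OF assms] unfolding conjdiag_eq_sum scaleR_sum_right scaleR_scaleR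
    by (intro sums_sum)
  then show ?thesis by (simp add: mexp_def sums_unique[symmetric])
qed

lemma trace_scaleR: "trace (c *\<^sub>R M) = c *\<^sub>R trace (M :: complex^'n^'n)"
  by (simp add: trace_def scaleR_sum_right)

lemma trace_sum: "trace (\<Sum>i\<in>S. M i) = (\<Sum>i\<in>S. trace (M i :: complex^'n^'n))"
  by (simp add: trace_def sum.swap[of _ S])

lemma trace_mult_cdiag: "trace (M ** cdiag x) = (\<Sum>i\<in>UNIV. x i *\<^sub>R M $ i $ i)"
  by (simp add: trace_def matrix_mult_cdiag_nth scaleR_conv_of_real mult.commute)

lemma trace_mult_conjdiag:
  "trace (M ** conjdiag U x) = trace (cadjoint U ** M ** U ** cdiag x)"
  by (metis conjdiag_def matrix_mul_assoc trace_mul_sym)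

text \<open>Entry \<open>(i, j)\<close> of \<open>cadjoint U ** V\<close> is the inner product of
  column \<open>i\<close> of \<open>U\<close> with column \<open>j\<close> of \<open>V\<close>. The
  weights are thus nonnegative and do not depend on \<open>x\<close> and \<open>y\<close>, which
  permits termwise comparison even for noncommuting matrices.\<close>

lemma Re_trace_conjdiag_mult:
  "Re (trace (conjdiag U x ** conjdiag V y)) =
    (\<Sum>i\<in>UNIV. \<Sum>j\<in>UNIV. x i * y j * (cmod ((cadjoint U ** V) $ i $ j))\<^sup>2)"
proof -
  define W where "W = cadjoint U ** V"
  have adjW: "cadjoint V ** U = cadjoint W"
    by (simp add: vec_eq_iff W_def cadjoint_def matrix_matrix_mult_def mult.commute)
  have "trace (conjdiag U x ** conjdiag V y) = trace (cadjoint W ** cdiag x ** W ** cdiag y)"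
    unfolding trace_mult_conjdiag adjW[symmetric] unfolding W_def conjdiag_def
    by (simp only: matrix_mul_assoc)
  also have "\<dots> = (\<Sum>j\<in>UNIV. \<Sum>i\<in>UNIV. (x i * y j) *\<^sub>R (cnj (W $ i $ j) * W $ i $ j))"
    by (simp add: trace_mult_cdiag matrix_matrix_mult_def[of _ W] matrix_mult_cdiag_nth cadjoint_def)
       (simp add: scaleR_conv_of_real sum_distrib_left mult_ac)
  also have "\<dots> = (\<Sum>i\<in>UNIV. \<Sum>j\<in>UNIV. (x i * y j) *\<^sub>R (cnj (W $ i $ j) * W $ i $ j))"
    by (rule sum.swap)
  also have "Re \<dots> = (\<Sum>i\<in>UNIV. \<Sum>j\<in>UNIV. x i * y j * (cmod (W $ i $ j))\<^sup>2)"
    by (simp add: cmod_power2) (simp add: power2_eq_square)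
  finally show ?thesis by (simp add: W_def)
qed

lemma Re_trace_mexp_pos:
  assumes "cadjoint A = A"
  shows "0 < Re (trace (mexp A))"
proof -
  obtain U a where U: "unitary U" "A = conjdiag U a"
    using hermitian_unitary_diagonalization[OF assms] .
  have "trace (mexp A) = trace (mat 1 ** conjdiag U (\<lambda>i. exp (a i)))"
    by (simp add: U mexp_conjdiag)
  also have "\<dots> = (\<Sum>i\<in>UNIV. exp (a i) *\<^sub>R 1)"
    unfolding trace_mult_conjdiag trace_mult_cdiag using U by (simp add: unitary_def) (simp add: mat_def)
  also have "Re \<dots> = (\<Sum>i\<in>UNIV. exp (a i))" by simp
  finally show ?thesis by (simp add: sum_pos)
qed

text \<open>In an eigenbasis of \<open>A\<close> the trace is a sum of diagonal entries of
  \<open>M\<close>, which are values of its quadratic form, weighted by positive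
  exponentials.\<close>

lemma Re_trace_cpsd_mexp:
  assumes "cpsd M" "cadjoint A = A"
  shows "0 \<le> Re (trace (M ** mexp A))"
proof -
  obtain U a where U: "unitary U" "A = conjdiag U a"
    using hermitian_unitary_diagonalization[OF assms(2)] .
  have "(cadjoint U ** M ** U) $ i $ i = cinner (column i U) (M *v column i U)" for i
    unfolding matrix_mul_assoc[symmetric]
    by (simp add: cinner_def matrix_matrix_mult_def matrix_vector_mult_def column_def cadjoint_def)
  then have "0 \<le> Re ((cadjoint U ** M ** U) $ i $ i)" for i
    using assms(1) by (simp add: Re_cinner cpsd_altdef)
  then show ?thesis
    unfolding U mexp_conjdiag[OF U(1)] trace_mult_conjdiag trace_mult_cdiag
    by (auto intro!: sum_nonneg)
qed

text \<open>This is Klein's inequality for the exponential.\<close>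

lemma trace_mexp_tangent_le:
  assumes "cadjoint A = A" "cadjoint B = B"
  shows "Re (trace ((B - A) ** mexp A)) \<le> Re (trace (mexp B)) - Re (trace (mexp A))"
proof -
  obtain U a where U: "unitary U" "A = conjdiag U a"
    using hermitian_unitary_diagonalization[OF assms(1)] .
  obtain V b where V: "unitary V" "B = conjdiag V b"
    using hermitian_unitary_diagonalization[OF assms(2)] .
  define S where "S x y = Re (trace (conjdiag U x ** conjdiag V y))" for x y
  define w where "w i j = (cmod ((cadjoint U ** V) $ i $ j))\<^sup>2" for i j
  have S: "S x y = (\<Sum>i\<in>UNIV. \<Sum>j\<in>UNIV. x i * y j * w i j)" for x y
    unfolding S_def w_def by (rule Re_trace_conjdiag_mult)
  have eA: "mexp A = conjdiag U (\<lambda>i. exp (a i))" and eB: "mexp B = conjdiag V (\<lambda>i. exp (b i))"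
    using U V by (simp_all add: mexp_conjdiag)
  \<comment> \<open>Inserting the identity as a function of the other matrix writes every trace as a
    double sum with the same weights \<open>w\<close>.\<close>
  have left: "Re (trace (conjdiag U x)) = S x (\<lambda>_. 1)" for x
    by (simp add: S_def conjdiag_one V)
  have right: "Re (trace (conjdiag V y)) = S (\<lambda>_. 1) y" for y
    by (simp add: S_def conjdiag_one U)
  have "Re (trace (mexp B)) - Re (trace (mexp A)) - Re (trace ((B - A) ** mexp A))
      = S (\<lambda>_. 1) (\<lambda>j. exp (b j)) - S (\<lambda>i. exp (a i)) (\<lambda>_. 1)
        - (S (\<lambda>i. exp (a i)) b - S (\<lambda>i. a i * exp (a i)) (\<lambda>_. 1))"
  proof -
    have "Re (trace (B ** mexp A)) = S (\<lambda>i. exp (a i)) b"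
      by (simp add: S_def eA V(2) trace_mul_sym[of "conjdiag V b"])
    moreover have "Re (trace (A ** mexp A)) = S (\<lambda>i. a i * exp (a i)) (\<lambda>_. 1)"
      unfolding eA unfolding U(2) by (simp add: conjdiag_mult U(1) left)
    ultimately show ?thesis
      by (simp add: matrix_diff_rdistrib trace_sub eA eB left right)
  qed
  also have "\<dots> = (\<Sum>i\<in>UNIV. \<Sum>j\<in>UNIV. (exp (b j) - exp (a i) * (1 + (b j - a i))) * w i j)"
    unfolding S sum_subtractf[symmetric] by (simp add: algebra_simps)
  also have "\<dots> \<ge> 0"
  proof (intro sum_nonneg mult_nonneg_nonneg)
    fix i j
    have "exp (a i) * (1 + (b j - a i)) \<le> exp (a i) * exp (b j - a i)"
      by (intro mult_left_mono exp_ge_add_one_self) simp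
    then show "0 \<le> exp (b j) - exp (a i) * (1 + (b j - a i))"
      by (simp flip: exp_add)
  qed (simp add: w_def)
  finally show ?thesis by simp
qed

text \<open>The logarithmic mean of \<open>exp a\<close> and \<open>exp b\<close> is at most their
  arithmetic mean, multiplied by \<open>(b - a)\<^sup>2\<close> to include \<open>a = b\<close>.
  Factoring out \<open>exp a\<close> leaves an inequality in \<open>d = b - a\<close>, proved by
  monotonicity of \<open>f\<close> from \<open>f 0 = 0\<close>.\<close>

lemma exp_log_mean_le_arithmetic_mean:
  fixes a b :: real
  shows "(b - a) * (exp b - exp a) \<le> (b - a)\<^sup>2 * ((exp a + exp b) / 2)"
proof -
  have *: "(b - a) * (exp b - exp a) \<le> (b - a)\<^sup>2 * ((exp a + exp b) / 2)" if "a \<le> b" for a b :: real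
  proof -
    define d where "d = b - a"
    define f where "f x = x * (1 + exp x) / 2 - exp x + 1" for x :: real
    have "f 0 \<le> f d"
    proof (rule DERIV_nonneg_imp_nondecreasing[of 0 d f])
      fix x :: real assume "0 \<le> x" "x \<le> d"
      have "1 - x \<le> exp (- x)" using exp_ge_add_one_self[of "-x"] by simp
      then have "(1 - x) * exp x \<le> exp (- x) * exp x" by (rule mult_right_mono) simp
      then have "0 \<le> (1 - exp x + x * exp x) / 2" by (simp add: algebra_simps flip: exp_add)
      moreover have "DERIV f x :> (1 - exp x + x * exp x) / 2"
        unfolding f_def by (auto intro!: derivative_eq_intros simp: field_simps)
      ultimately show "\<exists>y. DERIV f x :> y \<and> 0 \<le> y" by blast
    qed (use that in \<open>simp add: d_def\<close>)
    then have "exp d - 1 \<le> d * (1 + exp d) / 2" by (simp add: f_def)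
    then have "d * exp a * (exp d - 1) \<le> d * exp a * (d * (1 + exp d) / 2)"
      using that by (intro mult_left_mono) (auto simp: d_def)
    moreover have "exp b = exp a * exp d" by (simp add: d_def flip: exp_add)
    ultimately show ?thesis
      by (simp add: d_def[symmetric] power2_eq_square algebra_simps)
  qed
  show ?thesis
    using *[of a b] *[of b a] by (cases "a \<le> b") (auto simp: algebra_simps power2_eq_square)
qed

text \<open>Both sides become double sums with the same weights, and the scalar mean inequality
  compares them term by term.\<close>

lemma trace_mexp_difference_le:
  assumes "cadjoint A = A" "cadjoint B = B"
  shows "Re (trace ((B - A) ** mexp B)) - Re (trace ((B - A) ** mexp A))
    \<le> (Re (trace ((B - A) ** (B - A) ** mexp A)) + Re (trace ((B - A) ** (B - A) ** mexp B))) / 2"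
proof -
  obtain U a where U: "unitary U" "A = conjdiag U a"
    using hermitian_unitary_diagonalization[OF assms(1)] .
  obtain V b where V: "unitary V" "B = conjdiag V b"
    using hermitian_unitary_diagonalization[OF assms(2)] .
  define S where "S x y = Re (trace (conjdiag U x ** conjdiag V y))" for x y
  define w where "w i j = (cmod ((cadjoint U ** V) $ i $ j))\<^sup>2" for i j
  have S: "S x y = (\<Sum>i\<in>UNIV. \<Sum>j\<in>UNIV. x i * y j * w i j)" for x y
    unfolding S_def w_def by (rule Re_trace_conjdiag_mult)
  define ea eb where "ea i = exp (a i)" and "eb i = exp (b i)" for i
  have eA: "mexp A = conjdiag U ea" and eB: "mexp B = conjdiag V eb"
    using U V by (simp_all add: mexp_conjdiag ea_def[abs_def] eb_def[abs_def])
  note mult = conjdiag_mult[OF U(1)] conjdiag_mult[OF V(1)]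
  have left: "Re (trace (conjdiag U x)) = S x (\<lambda>_. 1)" for x
    by (simp add: S_def conjdiag_one V)
  have right: "Re (trace (conjdiag V y)) = S (\<lambda>_. 1) y" for y
    by (simp add: S_def conjdiag_one U)
  \<comment> \<open>All products occurring in the expansion are computed one by one; cyclicity of
    the trace gathers the functions of \<open>A\<close> on one side and those of \<open>B\<close> on
    the other.\<close>
  have t1: "Re (trace (B ** mexp B)) = S (\<lambda>_. 1) (\<lambda>j. b j * eb j)"
    unfolding eB unfolding V(2) by (simp add: mult right)
  have t2: "Re (trace (B ** mexp A)) = S ea b"
    by (simp add: S_def eA V(2) trace_mul_sym[of "conjdiag V b"])
  have t3: "Re (trace (A ** mexp B)) = S a eb"
    by (simp add: S_def eB U(2))
  have t4: "Re (trace (A ** mexp A)) = S (\<lambda>i. a i * ea i) (\<lambda>_. 1)"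
    unfolding eA unfolding U(2) by (simp add: mult left)
  have t5: "Re (trace (B ** B ** mexp A)) = S ea (\<lambda>j. b j * b j)"
    unfolding eA unfolding V(2) by (simp add: mult S_def trace_mul_sym[of "conjdiag V _"])
  have t6: "Re (trace (B ** A ** mexp A)) = S (\<lambda>i. a i * ea i) b"
    unfolding eA unfolding U(2) V(2) matrix_mul_assoc[symmetric]
    by (simp add: mult S_def trace_mul_sym[of "conjdiag V _"])
  have t7: "Re (trace (A ** B ** mexp A)) = S (\<lambda>i. a i * ea i) b"
  proof -
    have "trace (A ** B ** mexp A) = trace ((mexp A ** A) ** B)"
      by (metis matrix_mul_assoc trace_mul_sym)
    then show ?thesis
      unfolding eA unfolding U(2) V(2) by (simp add: mult S_def mult.commute)
  qed
  have t8: "Re (trace (A ** A ** mexp A)) = S (\<lambda>i. a i * a i * ea i) (\<lambda>_. 1)"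
    unfolding eA unfolding U(2) by (simp add: mult left)
  have t9: "Re (trace (B ** B ** mexp B)) = S (\<lambda>_. 1) (\<lambda>j. b j * b j * eb j)"
    unfolding eB unfolding V(2) by (simp add: mult right)
  have t10: "Re (trace (B ** A ** mexp B)) = S a (\<lambda>j. b j * eb j)"
  proof -
    have "trace (B ** A ** mexp B) = trace (A ** (mexp B ** B))"
      by (metis matrix_mul_assoc trace_mul_sym)
    then show ?thesis
      unfolding eB unfolding U(2) V(2) by (simp add: mult S_def mult.commute)
  qed
  have t11: "Re (trace (A ** B ** mexp B)) = S a (\<lambda>j. b j * eb j)"
    unfolding eB unfolding U(2) V(2) matrix_mul_assoc[symmetric]
    by (simp add: mult S_def)
  have t12: "Re (trace (A ** A ** mexp B)) = S (\<lambda>i. a i * a i) eb"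
    unfolding eB unfolding U(2) by (simp add: mult S_def)
  note t = t1 t2 t3 t4 t5 t6 t7 t8 t9 t10 t11 t12
  have "Re (trace ((B - A) ** mexp B)) - Re (trace ((B - A) ** mexp A))
      = (S (\<lambda>_. 1) (\<lambda>j. b j * eb j) - S a eb) - (S ea b - S (\<lambda>i. a i * ea i) (\<lambda>_. 1))"
    by (simp add: matrix_diff_rdistrib trace_sub t)
  also have "\<dots> = (\<Sum>i\<in>UNIV. \<Sum>j\<in>UNIV. ((b j - a i) * (exp (b j) - exp (a i))) * w i j)"
    unfolding S sum_subtractf[symmetric] by (simp add: ea_def eb_def algebra_simps)
  also have "\<dots> \<le> (\<Sum>i\<in>UNIV. \<Sum>j\<in>UNIV. ((b j - a i)\<^sup>2 * ((exp (a i) + exp (b j)) / 2)) * w i j)"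
    by (intro sum_mono mult_right_mono exp_log_mean_le_arithmetic_mean) (simp add: w_def)
  also have "\<dots> = ((S ea (\<lambda>j. b j * b j) - S (\<lambda>i. a i * ea i) b - (S (\<lambda>i. a i * ea i) b
       - S (\<lambda>i. a i * a i * ea i) (\<lambda>_. 1))) + (S (\<lambda>_. 1) (\<lambda>j. b j * b j * eb j)
       - S a (\<lambda>j. b j * eb j) - (S a (\<lambda>j. b j * eb j) - S (\<lambda>i. a i * a i) eb))) / 2"
    unfolding S sum_subtractf[symmetric] sum.distrib[symmetric] sum_divide_distrib
    by (simp add: ea_def eb_def power2_eq_square field_simps)
  also have "\<dots> = (Re (trace ((B - A) ** (B - A) ** mexp A))
      + Re (trace ((B - A) ** (B - A) ** mexp B))) / 2"
    by (simp add: matrix_diff_rdistrib matrix_diff_ldistrib trace_sub t)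
  finally show ?thesis .
qed

subsection \<open>The Hessian of the log-partition function\<close>

lemma cadjoint_mult: "cadjoint (A ** B) = cadjoint B ** cadjoint A"
  by (simp add: vec_eq_iff cadjoint_def matrix_matrix_mult_def mult.commute)

lemma cadjoint_diff: "cadjoint (A - B) = cadjoint A - cadjoint B"
  by (simp add: vec_eq_iff cadjoint_def)

lemma cadjoint_sum_scaleR:
  "cadjoint (\<Sum>j\<in>S. c j *\<^sub>R A j) = (\<Sum>j\<in>S. c j *\<^sub>R cadjoint (A j))"
  by (simp add: vec_eq_iff cadjoint_def)

lemma sum_scaleR_matrix_vector_mult:
  "(\<Sum>j\<in>S. c j *\<^sub>R A j) *v x = (\<Sum>j\<in>S. c j *\<^sub>R (A j *v (x :: complex^'n)))"
  by (simp add: vec_eq_iff matrix_vector_mult_def sum_distrib_right scaleR_sum_right sum.swap[of _ S])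

lemma hermitian_lincomb:
  assumes "\<forall>j. cpsd (F j)"
  shows "cadjoint (lincomb h F) = lincomb h F"
  using assms by (simp add: lincomb_def cadjoint_sum_scaleR cpsd_def)

lemma lincomb_diff: "lincomb x F - lincomb y F = lincomb (x - y) F"
  by (simp add: lincomb_def scaleR_left_diff_distrib sum_subtractf)

lemma lincomb_scaleR: "lincomb (c *\<^sub>R x) F = c *\<^sub>R lincomb x F"
  by (simp add: lincomb_def scaleR_sum_right)

lemma scaleR_matrix_mult: "(c *\<^sub>R A) ** B = c *\<^sub>R (A ** (B :: complex^'m^'n))"
  by (simp add: vec_eq_iff matrix_matrix_mult_def scaleR_sum_right)

lemma matrix_mult_scaleR: "A ** (c *\<^sub>R B) = c *\<^sub>R (A ** (B :: complex^'m^'n))"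
  by (simp add: vec_eq_iff matrix_matrix_mult_def scaleR_sum_right)

text \<open>This is the only step that uses the normalisation of the \<open>F j\<close>: with \<open>y = H x\<close> it is
  \<open>0 \<le> \<Sum>j. \<langle>h\<^sub>j x - y, F\<^sub>j (h\<^sub>j x - y)\<rangle>\<close>, expanded.\<close>

lemma cloewner_le_lincomb_square:
  fixes F :: "'k::finite \<Rightarrow> complex^'d^'d"
  assumes psd: "\<forall>j. cpsd (F j)"
    and sub: "cloewner_le (\<Sum>j\<in>UNIV. F j) (mat 1)"
  shows "cloewner_le (lincomb h F ** lincomb h F) (\<Sum>j\<in>UNIV. (h $ j)\<^sup>2 *\<^sub>R F j)"
proof -
  let ?H = "lincomb h F"
  have sa: "u \<bullet> (M *v v) = (M *v u) \<bullet> v" if "cadjoint M = M" for u v and M :: "complex^'d^'d"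
    by (metis Re_cinner cinner_adjoint that)
  have "cadjoint (?H ** ?H) = ?H ** ?H"
    by (simp add: cadjoint_mult hermitian_lincomb[OF psd])
  moreover have "0 \<le> x \<bullet> (((\<Sum>j\<in>UNIV. (h $ j)\<^sup>2 *\<^sub>R F j) - ?H ** ?H) *v x)" for x
  proof -
    define y where "y = ?H *v x"
    have "0 \<le> (\<Sum>j\<in>UNIV. (h $ j *\<^sub>R x - y) \<bullet> (F j *v (h $ j *\<^sub>R x - y)))"
      using psd by (intro sum_nonneg) (simp add: cpsd_altdef)
    also have "\<dots> = (\<Sum>j\<in>UNIV. (h $ j)\<^sup>2 * (x \<bullet> (F j *v x)) - 2 * (h $ j * (y \<bullet> (F j *v x)))
        + y \<bullet> (F j *v y))"
    proof (rule sum.cong[OF refl])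
      fix j
      have "F j *v (h $ j *\<^sub>R x - y) = h $ j *\<^sub>R (F j *v x) - F j *v y"
        by (simp add: linear_diff linear_cmul)
      moreover have "x \<bullet> (F j *v y) = y \<bullet> (F j *v x)"
        using sa[of "F j" x y] psd by (simp add: cpsd_def inner_commute)
      ultimately show "(h $ j *\<^sub>R x - y) \<bullet> (F j *v (h $ j *\<^sub>R x - y)) =
          (h $ j)\<^sup>2 * (x \<bullet> (F j *v x)) - 2 * (h $ j * (y \<bullet> (F j *v x))) + y \<bullet> (F j *v y)"
        by (simp add: inner_diff_left inner_diff_right power2_eq_square algebra_simps)
    qed
    \<comment> \<open>The \<open>h\<close>-weighted sum of the \<open>F j *v x\<close> is
      \<open>y\<close> itself, so the cross terms add up to \<open>- 2 * (y \<bullet> y)\<close>;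
      the normalisation then returns at most one \<open>y \<bullet> y\<close>.\<close>
    also have "\<dots> = x \<bullet> ((\<Sum>j\<in>UNIV. (h $ j)\<^sup>2 *\<^sub>R F j) *v x) - 2 * (y \<bullet> y)
        + y \<bullet> ((\<Sum>j\<in>UNIV. F j) *v y)"
      using sum_scaleR_matrix_vector_mult[of "\<lambda>_. 1" F UNIV y]
      by (simp add: y_def lincomb_def sum_scaleR_matrix_vector_mult inner_sum_right sum.distrib
          sum_subtractf sum_distrib_left)
    also have "y \<bullet> ((\<Sum>j\<in>UNIV. F j) *v y) \<le> y \<bullet> y"
    proof -
      have "0 \<le> y \<bullet> ((mat 1 - (\<Sum>j\<in>UNIV. F j)) *v y)"
        using sub unfolding cloewner_le_def cpsd_altdef by blast
      then show ?thesis
        by (simp add: matrix_vector_mult_diff_rdistrib inner_diff_right)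
    qed
    also have "y \<bullet> y = x \<bullet> (?H ** ?H *v x)"
      unfolding y_def matrix_vector_mul_assoc[symmetric]
      by (rule sa[OF hermitian_lincomb[OF psd], symmetric])
    finally show ?thesis
      by (simp add: matrix_vector_mult_diff_rdistrib inner_diff_right)
  qed
  ultimately show ?thesis
    using psd by (simp add: cloewner_le_def cpsd_altdef cadjoint_diff cadjoint_sum_scaleR)
qed

text \<open>Pairing with \<open>mexp A\<close> under the trace preserves the Loewner order, so the
  operator bound on the square becomes a bound by unnormalised mean values.\<close>

lemma Re_trace_lincomb_square_le:
  fixes F :: "'k::finite \<Rightarrow> complex^'d^'d"
  assumes psd: "\<forall>j. cpsd (F j)"
    and sub: "cloewner_le (\<Sum>j\<in>UNIV. F j) (mat 1)"
    and herm: "cadjoint A = A"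
  shows "Re (trace (lincomb h F ** lincomb h F ** mexp A))
    \<le> (\<Sum>j\<in>UNIV. (h $ j)\<^sup>2 * Re (trace (F j ** mexp A)))"
  using Re_trace_cpsd_mexp[OF cloewner_le_lincomb_square[OF psd sub, unfolded cloewner_le_def] herm]
  by (simp add: matrix_diff_rdistrib matrix_sum_rdistrib scaleR_matrix_mult trace_sub trace_sum
      trace_scaleR)

section \<open>The gradient of the log-partition function\<close>

lemma Re_trace_lincomb_mult:
  "Re (trace (lincomb h F ** M)) = (\<chi> j. Re (trace (F j ** M))) \<bullet> h"
  by (simp add: lincomb_def matrix_sum_rdistrib scaleR_matrix_mult trace_sum trace_scaleR
      inner_vec_def mult.commute)

text \<open>Positivity of the partition function makes it the exponential of \<open>logZ F\<close>,
  so its differentiability is inherited through the chain rule.\<close>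

lemma has_derivative_trace_mexp_lincomb:
  fixes F :: "'k::finite \<Rightarrow> complex^'d^'d"
  defines "Z \<equiv> \<lambda>mu. Re (trace (mexp (lincomb mu F)))"
  assumes psd: "\<forall>j. cpsd (F j)"
    and grad: "(logZ F has_derivative (\<lambda>h. g \<bullet> h)) (at mu)"
  shows "(Z has_derivative (\<lambda>h. Z mu * (g \<bullet> h))) (at mu)"
proof -
  have "Z = (\<lambda>mu. exp (logZ F mu))"
    using Re_trace_mexp_pos[OF hermitian_lincomb[OF psd]] by (simp add: Z_def logZ_def fun_eq_iff)
  then show ?thesis using grad by (auto intro!: derivative_eq_intros)
qed

text \<open>By Klein's inequality, \<open>Z\<close> minus the linear form given by \<open>T\<close>
  is minimal at \<open>mu\<close>, so its derivative there vanishes and \<open>T\<close> is the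
  gradient of \<open>Z\<close>.\<close>

lemma gradient_logZ:
  fixes F :: "'k::finite \<Rightarrow> complex^'d^'d"
  assumes psd: "\<forall>j. cpsd (F j)"
    and grad: "(logZ F has_derivative (\<lambda>h. g \<bullet> h)) (at mu)"
  shows "Re (trace (mexp (lincomb mu F))) *\<^sub>R g = (\<chi> j. Re (trace (F j ** mexp (lincomb mu F))))"
proof -
  define Z where "Z nu = Re (trace (mexp (lincomb nu F)))" for nu
  define T where "T = (\<chi> j. Re (trace (F j ** mexp (lincomb mu F))))"
  have "(Z has_derivative (\<lambda>h. Z mu * (g \<bullet> h))) (at mu)"
    unfolding Z_def by (rule has_derivative_trace_mexp_lincomb[OF psd grad])
  then have "((\<lambda>nu. Z nu - T \<bullet> (nu - mu)) has_derivative (\<lambda>h. Z mu * (g \<bullet> h) - T \<bullet> h)) (at mu)"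
    by (auto intro!: derivative_eq_intros)
  moreover have "Z mu - T \<bullet> (mu - mu) \<le> Z nu - T \<bullet> (nu - mu)" for nu
    using trace_mexp_tangent_le[of "lincomb mu F" "lincomb nu F"] hermitian_lincomb[OF psd]
    by (simp add: lincomb_diff Re_trace_lincomb_mult Z_def T_def)
  ultimately have "(\<lambda>h. Z mu * (g \<bullet> h) - T \<bullet> h) = (\<lambda>h. 0)"
    by (intro has_derivative_local_min) auto
  then have "(Z mu *\<^sub>R g - T) \<bullet> h = 0" for h
    by (simp add: inner_diff_left fun_eq_iff)
  then have "Z mu *\<^sub>R g - T = 0" by (metis inner_eq_zero_iff)
  then show ?thesis by (simp add: Z_def T_def)
qed

theorem theorem4p3:
  fixes F :: "'k::finite \<Rightarrow> complex^'d^'d"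
    and lam :: "real^'k"
    and G :: "real^'k \<Rightarrow> real^'k"
    and L :: "real^'k^'k"
  assumes psd: "\<forall>j. cpsd (F j)"
    and sub: "cloewner_le (\<Sum>j\<in>UNIV. F j) (mat 1)"
    and grad: "\<forall>mu. (logZ F has_derivative (\<lambda>h. G mu \<bullet> h)) (at mu)"
    and hess: "(G has_derivative (\<lambda>h. L *v h)) (at lam)"
  shows "rloewner_le L (meanmat F lam)"
proof -
  define Z where "Z mu = Re (trace (mexp (lincomb mu F)))" for mu
  note herm = hermitian_lincomb[OF psd]
  have Zpos: "Z mu > 0" for mu
    unfolding Z_def by (rule Re_trace_mexp_pos[OF herm])
  have ZG: "Z mu *\<^sub>R G mu = (\<chi> j. Re (trace (F j ** mexp (lincomb mu F))))" for mu
    unfolding Z_def using gradient_logZ[OF psd] grad by blast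
  have ZGj: "Re (trace (F j ** mexp (lincomb mu F))) = Z mu * G mu $ j" for mu j
    using arg_cong[OF ZG, of "\<lambda>v. v $ j" mu] by simp
  have tr_lincomb: "Re (trace (lincomb h F ** mexp (lincomb mu F))) = Z mu * (G mu \<bullet> h)" for h mu
    by (simp add: Re_trace_lincomb_mult flip: ZG)
  \<comment> \<open>The mean values are the components of the gradient: the factor
    \<open>Z lam\<close> from \<open>ZGj\<close> cancels the normalisation of
    \<open>gibbs\<close>.\<close>
  have mean: "meanmat F lam = (\<chi> i j. if i = j then G lam $ i else 0)"
    using Zpos[of lam]
    by (simp add: meanmat_def gibbs_def matrix_mult_scaleR trace_scaleR ZGj vec_eq_iff
        flip: Z_def)
  have dZ: "(Z has_derivative (\<lambda>h. Z mu * (G mu \<bullet> h))) (at mu)" for mu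
    unfolding Z_def using has_derivative_trace_mexp_lincomb[OF psd] grad by blast
  have quad: "h \<bullet> (L *v h) \<le> (\<Sum>j\<in>UNIV. (h $ j)\<^sup>2 * G lam $ j)" for h
  proof -
    \<comment> \<open>Everything is restricted to the line through \<open>lam\<close> in direction
      \<open>h\<close>. There \<open>\<phi>\<close> is the directional derivative of
      \<open>Z\<close>, and \<open>Q\<close> is the trace bound for the square of
      \<open>lincomb h F\<close>.\<close>
    define \<gamma> where "\<gamma> t = lam + t *\<^sub>R h" for t
    define \<phi> where "\<phi> t = Z (\<gamma> t) * (G (\<gamma> t) \<bullet> h)" for t
    define Q where "Q t = (\<Sum>j\<in>UNIV. (h $ j)\<^sup>2 * (Z (\<gamma> t) * G (\<gamma> t) $ j))" for t
    have \<gamma>0: "\<gamma> 0 = lam" by (simp add: \<gamma>_def)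
    have d\<gamma>: "(\<gamma> has_derivative (\<lambda>t. t *\<^sub>R h)) (at 0)"
      unfolding \<gamma>_def by (auto intro!: derivative_eq_intros)
    have dZ\<gamma>: "((\<lambda>t. Z (\<gamma> t)) has_derivative (\<lambda>t. Z lam * (G lam \<bullet> (t *\<^sub>R h)))) (at 0)"
      by (rule has_derivative_compose[OF d\<gamma>, unfolded \<gamma>0, OF dZ])
    have dG\<gamma>: "((\<lambda>t. G (\<gamma> t)) has_derivative (\<lambda>t. L *v (t *\<^sub>R h))) (at 0)"
      by (rule has_derivative_compose[OF d\<gamma>, unfolded \<gamma>0, OF hess])
    have "(\<phi> has_derivative (\<lambda>t. Z lam * ((L *v (t *\<^sub>R h)) \<bullet> h)
        + Z lam * (G lam \<bullet> (t *\<^sub>R h)) * (G lam \<bullet> h))) (at 0)"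
      unfolding \<phi>_def using dZ\<gamma> dG\<gamma>
      by (auto intro!: derivative_eq_intros simp: \<gamma>0)
    \<comment> \<open>The square comes from the product rule: the derivative of \<open>Z\<close>
      along \<open>h\<close> is itself \<open>Z\<close> times
      \<open>G lam \<bullet> h\<close>.\<close>
    then have "(\<phi> has_real_derivative Z lam * (h \<bullet> (L *v h) + (G lam \<bullet> h)\<^sup>2)) (at 0)"
      unfolding has_field_derivative_def
      by (rule has_derivative_eq_rhs)
         (simp add: fun_eq_iff linear_cmul inner_commute power2_eq_square algebra_simps)
    then have "((\<lambda>t. (\<phi> t - \<phi> 0) / t) \<longlongrightarrow> Z lam * (h \<bullet> (L *v h) + (G lam \<bullet> h)\<^sup>2)) (at_right 0)"
      unfolding has_field_derivative_iff by (auto intro: tendsto_mono[OF at_le])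
    moreover have "((\<lambda>t. (Q 0 + Q t) / 2) \<longlongrightarrow> (Q 0 + Q 0) / 2) (at_right 0)"
    proof -
      have "isCont (\<lambda>t. Z (\<gamma> t)) 0" "isCont (\<lambda>t. G (\<gamma> t)) 0"
        using dZ\<gamma> dG\<gamma> by (auto dest: has_derivative_continuous)
      then have "isCont Q 0"
        unfolding Q_def by (intro continuous_intros)
      then have "(Q \<longlongrightarrow> Q 0) (at_right 0)"
        unfolding isCont_def by (rule tendsto_mono[OF at_le, rotated]) simp
      then show ?thesis by (intro tendsto_intros) auto
    qed
    moreover have "\<forall>\<^sub>F t in at_right 0. (\<phi> t - \<phi> 0) / t \<le> (Q 0 + Q t) / 2"
      unfolding eventually_at_right_field
    proof (intro exI[of _ 1] conjI allI impI)
      fix t :: real assume "0 < t" "t < 1"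
      have diff: "lincomb (\<gamma> t) F - lincomb lam F = t *\<^sub>R lincomb h F"
        by (simp add: lincomb_diff \<gamma>_def lincomb_scaleR)
      have Q: "Re (trace (lincomb h F ** lincomb h F ** mexp (lincomb (\<gamma> s) F))) \<le> Q s" for s
        unfolding Q_def ZGj[symmetric] by (rule Re_trace_lincomb_square_le[OF psd sub herm])
      \<comment> \<open>With difference \<open>t *\<^sub>R lincomb h F\<close>, the left side of the
        trace bound carries one factor \<open>t\<close> and the right side two. Cancelling one
        leaves a bound that can be divided by \<open>t\<close> and passed to the limit.\<close>
      have "t * (\<phi> t - \<phi> 0) \<le>
          t\<^sup>2 * ((Re (trace (lincomb h F ** lincomb h F ** mexp (lincomb (\<gamma> 0) F)))
            + Re (trace (lincomb h F ** lincomb h F ** mexp (lincomb (\<gamma> t) F)))) / 2)"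
        using trace_mexp_difference_le[OF herm[of lam] herm[of "\<gamma> t"]]
        unfolding diff
        by (simp add: scaleR_matrix_mult matrix_mult_scaleR trace_scaleR tr_lincomb \<phi>_def \<gamma>0
            power2_eq_square algebra_simps add_divide_distrib)
      also have "\<dots> \<le> t\<^sup>2 * ((Q 0 + Q t) / 2)"
        by (intro mult_left_mono divide_right_mono add_mono Q) auto
      finally have "\<phi> t - \<phi> 0 \<le> t * ((Q 0 + Q t) / 2)"
        using \<open>0 < t\<close> by (simp only: power2_eq_square mult.assoc mult_le_cancel_left_pos)
      then show "(\<phi> t - \<phi> 0) / t \<le> (Q 0 + Q t) / 2"
        using \<open>0 < t\<close> by (simp only: pos_divide_le_eq mult.commute)
    qed simp
    ultimately have "Z lam * (h \<bullet> (L *v h) + (G lam \<bullet> h)\<^sup>2) \<le> (Q 0 + Q 0) / 2"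
      by - (rule tendsto_le[OF trivial_limit_at_right_real]; assumption)
    also have "\<dots> = Z lam * (\<Sum>j\<in>UNIV. (h $ j)\<^sup>2 * G lam $ j)"
      by (simp add: Q_def \<gamma>0 sum_distrib_left mult_ac)
    finally have "h \<bullet> (L *v h) + (G lam \<bullet> h)\<^sup>2 \<le> (\<Sum>j\<in>UNIV. (h $ j)\<^sup>2 * G lam $ j)"
      using Zpos by simp
    \<comment> \<open>The discarded square is that of the mean of \<open>lincomb h F\<close> in the
      Gibbs state.\<close>
    then show ?thesis using zero_le_power2[of "G lam \<bullet> h"] by linarith
  qed
  \<comment> \<open>\<open>rpsd\<close> includes symmetry, so the entries of \<open>L\<close> are
    compared by testing the symmetric second derivative on coordinate vectors.\<close>
  have "transpose L = L"
  proof -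
    have "L $ i $ j = L $ j $ i" for i j
      using second_derivative_symmetric[OF _ hess, of "logZ F" "axis i 1" "axis j 1"] grad
      by (simp add: inner_axis' matrix_vector_mult_basis column_def)
    then show ?thesis by (simp add: transpose_def vec_eq_iff)
  qed
  then have "transpose (meanmat F lam - L) = meanmat F lam - L"
    by (auto simp: mean transpose_def vec_eq_iff)
  moreover have "h \<bullet> (meanmat F lam *v h) = (\<Sum>j\<in>UNIV. (h $ j)\<^sup>2 * G lam $ j)" for h
    by (simp add: mean inner_vec_def matrix_vector_mult_def if_distrib[of "\<lambda>x. x * _"]
        cong: if_cong) (simp add: power2_eq_square mult_ac)
  ultimately show ?thesis
    using quad by (simp add: rloewner_le_def rpsd_def matrix_vector_mult_diff_rdistrib inner_diff_right)
qed

end
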